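(* Let $d\in\mathbb{N}$ and $0<p<u\le\infty$. Then $m_{u,p}(\mathbb{Z}^d)$ is non-separable.
   Context: For $j\in\mathbb{Z}$, $m\in\mathbb{Z}^d$, the dyadic cubes are $Q_{j,m}=2^{-j}(m+[0,1)^d)\subset\mathbb{R}^d$, so $|Q_{-j,m}|=2^{jd}$. For $0<p<\infty$ and $p\le u\le\infty$ (with $\frac1\infty=0$), $m_{u,p}(\mathbb{Z}^d)$ consists of all $\lambda=\{\lambda_k\}_{k\in\mathbb{Z}^d}\subset\mathbb{C}$ with $$\|\lambda|m_{u,p}\|=\sup_{j\in\mathbb{N}_0,\,m\in\mathbb{Z}^d}|Q_{-j,m}|^{\frac1u-\frac1p}\Big(\sum_{k:\,Q_{0,k}\subset Q_{-j,m}}|\lambda_k|^p\Big)^{1/p}<\infty ,$$ equipped with the topology of this (quasi-)norm. *)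

theory Defs
  imports "HOL-Analysis.Analysis"
begin

text \<open>
  The dimension $d$ is the cardinality of a finite type \<open>'d\<close>; points of
  $\mathbb{R}^d$ and $\mathbb{Z}^d$ have types \<open>real ^ 'd\<close> and \<open>int ^ 'd\<close>.
\<close>

definition dyadic_cube :: "int \<Rightarrow> int ^ 'd::finite \<Rightarrow> (real ^ 'd) set"
  where "dyadic_cube j m =
    (\<lambda>y. (2 powi (- j)) *\<^sub>R ((\<chi> i. real_of_int (m $ i)) + y)) ` {y. \<forall>i. 0 \<le> y $ i \<and> y $ i < 1}"

lemma mem_dyadic_cube:
  "x \<in> dyadic_cube j m \<longleftrightarrow>
    (\<forall>i. 2 powi (- j) * real_of_int (m $ i) \<le> x $ i \<and> x $ i < 2 powi (- j) * (real_of_int (m $ i) + 1))"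
  (is "_ \<longleftrightarrow> ?R")
proof
  assume "x \<in> dyadic_cube j m"
  then show ?R
    by (auto simp: dyadic_cube_def)
next
  assume R: ?R
  define c :: real where "c = 2 powi (- j)"
  have c: "c > 0" by (simp add: c_def)
  define y where "y = x /\<^sub>R c - (\<chi> i. real_of_int (m $ i))"
  have "x = c *\<^sub>R ((\<chi> i. real_of_int (m $ i)) + y)"
    using c by (simp add: y_def)
  moreover have "\<forall>i. 0 \<le> y $ i \<and> y $ i < 1"
    using R c by (simp add: y_def c_def[symmetric] field_simps)
  ultimately show "x \<in> dyadic_cube j m"
    unfolding dyadic_cube_def c_def by blast
qed

lemma finite_dyadic_subcubes:
  "finite {k. dyadic_cube 0 k \<subseteq> dyadic_cube j (m :: int ^ 'd::finite)}"
proof -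
  define F where "F i = {\<lfloor>2 powi (- j) * real_of_int (m $ i)\<rfloor>..\<lceil>2 powi (- j) * (real_of_int (m $ i) + 1)\<rceil>}" for i
  have "{k. dyadic_cube 0 k \<subseteq> dyadic_cube j m} \<subseteq> vec_lambda ` PiE UNIV F"
  proof
    fix k assume "k \<in> {k. dyadic_cube 0 k \<subseteq> dyadic_cube j m}"
    moreover have "(\<chi> i. real_of_int (k $ i)) \<in> dyadic_cube 0 k"
      by (simp add: mem_dyadic_cube)
    ultimately have "(\<chi> i. real_of_int (k $ i)) \<in> dyadic_cube j m"
      by blast
    then have "2 powi (- j) * real_of_int (m $ i) \<le> real_of_int (k $ i)"
      "real_of_int (k $ i) \<le> 2 powi (- j) * (real_of_int (m $ i) + 1)" for i
      by (auto simp: mem_dyadic_cube intro: less_imp_le)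
    then have "k $ i \<in> F i" for i
      unfolding F_def atLeastAtMost_iff
      by (metis floor_mono floor_of_int ceiling_mono ceiling_of_int)
    then have "vec_nth k \<in> PiE UNIV F"
      by auto
    then show "k \<in> vec_lambda ` PiE UNIV F"
      by (metis image_eqI vec_nth_inverse)
  qed
  moreover have "finite (PiE UNIV F)"
    by (rule finite_PiE) (auto simp: F_def)
  ultimately show ?thesis
    by (meson finite_imageI finite_subset)
qed

lemma measure_dyadic_cube:
  "measure lebesgue (dyadic_cube (- int j) (m :: int ^ 'd::finite)) = 2 ^ (j * CARD('d))"
proof -
  define a b :: "real ^ 'd"
    where "a = (\<chi> i. 2 ^ j * real_of_int (m $ i))" and "b = (\<chi> i. 2 ^ j * (real_of_int (m $ i) + 1))"
  have "measure lebesgue (dyadic_cube (- int j) m) = measure lebesgue (cbox a b)"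
  proof (rule measure_negligible_symdiff)
    have sub: "box a b \<subseteq> dyadic_cube (- int j) m" "dyadic_cube (- int j) m \<subseteq> cbox a b"
      by (fastforce simp: a_def b_def mem_box_cart mem_dyadic_cube intro: less_imp_le)+
    then show "negligible ((cbox a b - dyadic_cube (- int j) m) \<union> (dyadic_cube (- int j) m - cbox a b))"
      by (intro negligible_subset[OF negligible_frontier_interval[of a b]]) auto
  qed simp
  also have "\<dots> = (\<Prod>i\<in>UNIV. b $ i - a $ i)"
    by (simp add: content_cbox_cart a_def b_def interval_ne_empty_cart)
  also have "\<dots> = 2 ^ (j * CARD('d))"
    by (simp add: a_def b_def algebra_simps power_mult)
  finally show ?thesis .
qed

text \<open>
  In \<open>ereal\<close>, \<open>1 / \<infinity> = 0\<close>. By \<open>finite_dyadic_subcubes\<close> the sum always ranges over a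
  finite set.
\<close>

definition m_norm :: "ereal \<Rightarrow> real \<Rightarrow> (int ^ 'd::finite \<Rightarrow> complex) \<Rightarrow> ennreal"
  where "m_norm u p a =
    (SUP (j, m) \<in> (UNIV :: (nat \<times> (int ^ 'd)) set).
      ennreal (measure lebesgue (dyadic_cube (- int j) m) powr (real_of_ereal (1 / u) - 1 / p) *
        (\<Sum>k | dyadic_cube 0 k \<subseteq> dyadic_cube (- int j) m. cmod (a k) powr p) powr (1 / p)))"

definition m_space :: "ereal \<Rightarrow> real \<Rightarrow> (int ^ 'd::finite \<Rightarrow> complex) set"
  where "m_space u p = {a. m_norm u p a < \<infinity>}"

definition m_topology :: "ereal \<Rightarrow> real \<Rightarrow> (int ^ 'd::finite \<Rightarrow> complex) topology"
  where "m_topology u p = topology (\<lambda>U. U \<subseteq> m_space u p \<and>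
    (\<forall>a\<in>U. \<exists>e>0. \<forall>b\<in>m_space u p. m_norm u p (\<lambda>k. b k - a k) < ennreal e \<longrightarrow> b \<in> U))"

lemma openin_m_topology:
  fixes U :: "(int ^ 'd::finite \<Rightarrow> complex) set"
  shows "openin (m_topology u p) U \<longleftrightarrow> U \<subseteq> m_space u p \<and>
    (\<forall>a\<in>U. \<exists>e>0. \<forall>b\<in>m_space u p. m_norm u p (\<lambda>k. b k - a k) < ennreal e \<longrightarrow> b \<in> U)"
proof -
  have "istopology (\<lambda>U :: (int ^ 'd \<Rightarrow> complex) set. U \<subseteq> m_space u p \<and>
    (\<forall>a\<in>U. \<exists>e>0. \<forall>b\<in>m_space u p. m_norm u p (\<lambda>k. b k - a k) < ennreal e \<longrightarrow> b \<in> U))"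
    (is "istopology ?P")
    unfolding istopology_def
  proof (intro conjI allI impI)
    fix S T assume S: "?P S" and T: "?P T"
    show "S \<inter> T \<subseteq> m_space u p" using S by blast
    show "\<forall>a\<in>S \<inter> T. \<exists>e>0. \<forall>b\<in>m_space u p. m_norm u p (\<lambda>k. b k - a k) < ennreal e \<longrightarrow> b \<in> S \<inter> T"
    proof
      fix a assume "a \<in> S \<inter> T"
      then obtain e1 e2 where e: "e1 > 0" "e2 > 0"
        and e1: "\<forall>b\<in>m_space u p. m_norm u p (\<lambda>k. b k - a k) < ennreal e1 \<longrightarrow> b \<in> S"
        and e2: "\<forall>b\<in>m_space u p. m_norm u p (\<lambda>k. b k - a k) < ennreal e2 \<longrightarrow> b \<in> T"
        using S T by blast
      have "x < ennreal e1 \<and> x < ennreal e2" if "x < ennreal (min e1 e2)" for x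
        using that ennreal_leI[of "min e1 e2"] by (auto intro: order.strict_trans2)
      with e e1 e2 show "\<exists>e>0. \<forall>b\<in>m_space u p. m_norm u p (\<lambda>k. b k - a k) < ennreal e \<longrightarrow> b \<in> S \<inter> T"
        by (intro exI[of _ "min e1 e2"]) simp
    qed
  next
    fix K assume "\<forall>U\<in>K. ?P U"
    then show "\<Union>K \<subseteq> m_space u p"
      by blast
  next
    fix K assume K: "\<forall>U\<in>K. ?P U"
    show "\<forall>a\<in>\<Union>K. \<exists>e>0. \<forall>b\<in>m_space u p. m_norm u p (\<lambda>k. b k - a k) < ennreal e \<longrightarrow> b \<in> \<Union>K"
      using K by (meson Union_iff)
  qed
  then show ?thesis
    unfolding m_topology_def by (simp only: topology_inverse')
qed

lemma topspace_m_topology [simp]: "topspace (m_topology u p) = m_space u p"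
proof
  show "topspace (m_topology u p) \<subseteq> m_space u p"
    by (metis openin_m_topology openin_topspace)
  have "openin (m_topology u p) (m_space u p)"
    unfolding openin_m_topology by (auto intro: exI[of _ 1])
  then show "m_space u p \<subseteq> topspace (m_topology u p)"
    by (rule openin_subset)
qed

end

theory Submission
  imports Defs
begin

text \<open>
  Sets of points \<open>(2\<^sup>n, \<dots>, 2\<^sup>n)\<close> are so sparse that a cube of side length \<open>2\<^sup>j\<close>
  contains at most \<open>j + 1\<close> of them. Since \<open>p < u\<close>, the weight \<open>2 powr (j d (1/u - 1/p))\<close> decays
  exponentially in \<open>j\<close>, so the indicators of all these sets lie in the space. There are uncountably
  many of them, and as the (quasi-)norm dominates the supremum norm, the open sup-norm balls of
  radius \<open>1/2\<close> around them are open and pairwise disjoint. A separable space admits only countably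
  many pairwise disjoint nonempty open sets.
\<close>

text \<open>A countable dense set meets every \<open>U i\<close>; choosing one of its points in each
  \<open>U i\<close> is injective by disjointness.\<close>

lemma separable_space_imp_countable_disjoint_open:
  assumes "separable_space X"
    and U: "\<And>i. i \<in> I \<Longrightarrow> openin X (U i)" "\<And>i. i \<in> I \<Longrightarrow> U i \<noteq> {}"
    and disj: "disjoint_family_on U I"
  shows "countable I"
proof -
  obtain C where C: "countable C" "X closure_of C = topspace X"
    using assms(1) unfolding separable_space_def by blast
  have "\<exists>c. c \<in> C \<and> c \<in> U i" if i: "i \<in> I" for i
  proof -
    obtain x where "x \<in> U i"
      using U(2)[OF i] by blast
    then have "x \<in> X closure_of C"
      using C(2) openin_subset[OF U(1)[OF i]] by blast
    then show ?thesis
      using \<open>x \<in> U i\<close> U(1)[OF i] unfolding in_closure_of by blast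
  qed
  then obtain f where f: "\<And>i. i \<in> I \<Longrightarrow> f i \<in> C \<and> f i \<in> U i"
    by metis
  have "inj_on f I"
    using f disj unfolding inj_on_def disjoint_family_on_def by (metis IntI empty_iff)
  moreover have "countable (f ` I)"
    using f by (intro countable_subset[OF _ C(1)]) blast
  ultimately show ?thesis
    by (rule countable_image_inj_on[rotated])
qed

lemma dyadic_cube_0_subset_iff:
  "dyadic_cube 0 k \<subseteq> dyadic_cube 0 m \<longleftrightarrow> k = m"
proof
  assume "dyadic_cube 0 k \<subseteq> dyadic_cube 0 m"
  moreover have "(\<chi> i. real_of_int (k $ i)) \<in> dyadic_cube 0 k"
    by (simp add: mem_dyadic_cube)
  ultimately have "(\<chi> i. real_of_int (k $ i)) \<in> dyadic_cube 0 m"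
    by blast
  then have "k $ i = m $ i" for i
    by (simp add: mem_dyadic_cube) (smt (verit) of_int_1 of_int_add of_int_le_iff of_int_less_iff)
  then show "k = m"
    by (simp add: vec_eq_iff)
qed simp

lemma norm_le_m_norm:
  assumes "p > 0"
  shows "ennreal (cmod (a k)) \<le> m_norm u p a"
proof -
  have "measure lebesgue (dyadic_cube 0 k) = 1"
    using measure_dyadic_cube[of 0 k] by simp
  then show ?thesis
    unfolding m_norm_def using assms
    \<comment> \<open>The unit cube at \<open>k\<close> competes in the supremum: its weight is 1
      and its sum has the single term at \<open>k\<close>.\<close>
    by (intro SUP_upper2[where i = "(0, k)"]) (simp_all add: dyadic_cube_0_subset_iff powr_powr)
qed

text \<open>Balls of a mere quasi-norm need not be open, whereas the sup norm obeys the triangle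
  inequality and is dominated by \<open>m_norm\<close>. The bound \<open>s < r\<close>, uniform in
  \<open>k\<close>, leaves room for a perturbation; \<open>cmod (b k - a k) < r\<close> for each
  \<open>k\<close> separately would not.\<close>

lemma openin_m_topology_sup_ball:
  assumes "p > 0"
  shows "openin (m_topology u p) {b \<in> m_space u p. \<exists>s<r. \<forall>k. cmod (b k - a k) \<le> s}"
  unfolding openin_m_topology
proof (intro conjI ballI)
  fix b assume "b \<in> {b \<in> m_space u p. \<exists>s<r. \<forall>k. cmod (b k - a k) \<le> s}"
  then obtain s where s: "s < r" "\<And>k. cmod (b k - a k) \<le> s"
    by blast
  define e where "e = (r - s) / 2"
  have "e > 0" using s by (simp add: e_def)
  have "cmod (c k - a k) \<le> s + e" if "m_norm u p (\<lambda>k. c k - b k) < ennreal e" for c k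
  proof -
    have "ennreal (cmod (c k - b k)) < ennreal e"
      using norm_le_m_norm[OF assms, of "\<lambda>k. c k - b k" k u] that by (rule order.strict_trans1)
    then have "cmod (c k - b k) < e"
      by (simp add: ennreal_less_iff)
    then show ?thesis
      using s(2)[of k] norm_triangle_ineq[of "c k - b k" "b k - a k"] by simp
  qed
  moreover have "s + e < r"
    using s by (simp add: e_def field_simps)
  ultimately show "\<exists>e>0. \<forall>c\<in>m_space u p. m_norm u p (\<lambda>k. c k - b k) < ennreal e \<longrightarrow>
      c \<in> {b \<in> m_space u p. \<exists>s<r. \<forall>k. cmod (b k - a k) \<le> s}"
    using \<open>e > 0\<close> by blast
qed blast

text \<open>There are only \<open>j\<close> exponents below \<open>j\<close>. For
  \<open>n \<ge> j\<close> the power \<open>2 ^ n\<close> is a multiple of \<open>2 ^ j\<close>, and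
  the only such multiple in the interval is its left endpoint.\<close>

lemma card_powers_of_two_in_dyadic_interval:
  fixes m :: int
  shows "finite {n. 2 ^ j * m \<le> 2 ^ n \<and> 2 ^ n < 2 ^ j * (m + 1)}" (is "finite ?N")
    and "card {n. 2 ^ j * m \<le> 2 ^ n \<and> 2 ^ n < 2 ^ j * (m + 1)} \<le> j + 1"
proof -
  have pow: "2 ^ n = 2 ^ j * m" if "n \<in> ?N" "n \<ge> j" for n
  proof -
    have n: "(2 :: int) ^ n = 2 ^ j * 2 ^ (n - j)"
      using that(2) by (simp flip: power_add)
    have "2 ^ j * m \<le> 2 ^ j * 2 ^ (n - j) \<and> (2 :: int) ^ j * 2 ^ (n - j) < 2 ^ j * (m + 1)"
      using that(1) unfolding mem_Collect_eq n .
    then have "m = 2 ^ (n - j)"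
      unfolding mult_le_cancel_left mult_less_cancel_left by simp
    then show ?thesis
      using n by simp
  qed
  obtain n0 where n0: "?N \<subseteq> insert n0 {..<j}"
  proof (cases "\<exists>n0\<in>?N. n0 \<ge> j")
    case True
    then obtain n0 where n0: "n0 \<in> ?N" "n0 \<ge> j" by blast
    have "n = n0" if "n \<in> ?N" "n \<ge> j" for n
    proof -
      have "(2 :: int) ^ n = 2 ^ n0"
        by (rule trans[OF pow[OF that] pow[OF n0, symmetric]])
      then show ?thesis by simp
    qed
    then have "?N \<subseteq> insert n0 {..<j}"
      using not_le by blast
    then show ?thesis by (rule that)
  next
    case False
    \<comment> \<open>No exponent reaches \<open>j\<close>, so the extra element 0 is
      arbitrary.\<close>
    then have "?N \<subseteq> insert 0 {..<j}"
      using not_le by blast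
    then show ?thesis by (rule that)
  qed
  have "card (insert n0 {..<j}) \<le> j + 1"
    using card_insert_le_m1[of "j + 1" "{..<j}" n0] by simp
  with card_mono[OF _ n0] show "card ?N \<le> j + 1"
    by simp
  show "finite ?N"
    using n0 by (rule finite_subset) simp
qed

definition diagonal_power :: "nat \<Rightarrow> int ^ 'd::finite"
  where "diagonal_power n = (\<chi> i. 2 ^ n)"

lemma inj_diagonal_power: "inj diagonal_power"
  by (auto simp: inj_def diagonal_power_def vec_eq_iff)

lemma card_diagonal_power_in_dyadic_cube:
  "card (range diagonal_power \<inter> {k. dyadic_cube 0 k \<subseteq> dyadic_cube (- int j) (m :: int ^ 'd::finite)}) \<le> j + 1"
proof -
  \<comment> \<open>The coordinates of a diagonal point agree, so any single one already yields the
    bound.\<close>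
  fix i :: 'd
  define N where "N = {n. 2 ^ j * m $ i \<le> 2 ^ n \<and> 2 ^ n < 2 ^ j * (m $ i + 1)}"
  have "n \<in> N" if "dyadic_cube 0 (diagonal_power n) \<subseteq> dyadic_cube (- int j) m" for n
  proof -
    have "(\<chi> i. 2 ^ n) \<in> dyadic_cube 0 (diagonal_power n)"
      by (simp add: mem_dyadic_cube diagonal_power_def)
    then have "(\<chi> i. 2 ^ n) \<in> dyadic_cube (- int j) m"
      using that by blast
    then have "real_of_int (2 ^ j * m $ i) \<le> real_of_int (2 ^ n)"
      "real_of_int (2 ^ n) < real_of_int (2 ^ j * (m $ i + 1))"
      by (auto simp: mem_dyadic_cube)
    then show ?thesis
      unfolding N_def of_int_le_iff of_int_less_iff by blast
  qed
  then have "range diagonal_power \<inter> {k. dyadic_cube 0 k \<subseteq> dyadic_cube (- int j) m} \<subseteq> diagonal_power ` N"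
    by blast
  moreover have "finite N" "card N \<le> j + 1"
    unfolding N_def by (rule card_powers_of_two_in_dyadic_interval)+
  ultimately show ?thesis
    by (meson card_image_le card_mono finite_imageI order_trans)
qed

lemma sparse_indicator_in_m_space:
  fixes S :: "(int ^ 'd::finite) set"
  assumes "p > 0" and u: "ereal p < u"
    and card: "\<And>j m. card (S \<inter> {k. dyadic_cube 0 k \<subseteq> dyadic_cube (- int j) m}) \<le> j + 1"
  shows "indicator S \<in> m_space u p"
proof -
  define r where "r = real_of_ereal (1 / u)"
  have r: "r < 1 / p"
  \<comment> \<open>For \<open>u = \<infinity>\<close> the value of \<open>r\<close> is 0, and
    \<open>u = -\<infinity>\<close> contradicts \<open>ereal p < u\<close>.\<close>
  proof (cases u)
    case (real v)
    then show ?thesis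
      using assms(1) u by (simp add: r_def one_ereal_def frac_less2)
  qed (use assms(1) u in \<open>auto simp: r_def\<close>)
  \<comment> \<open>Chosen so that the weight of a cube of side \<open>2 ^ j\<close> is exactly
    \<open>exp (- (c * j))\<close>.\<close>
  define c where "c = CARD('d) * (1 / p - r) * ln 2"
  have "c > 0"
    using r by (simp add: c_def)
  \<comment> \<open>Makes both \<open>K\<close> and \<open>K * (c * p)\<close> at least 1, hence
    \<open>1 + j \<le> K * (1 + c * p * j)\<close>; then \<open>1 + x \<le> exp x\<close>
    applies.\<close>
  define K where "K = max 1 (1 / (c * p))"
  have growth: "real (j + 1) \<le> K * exp (c * p * j)" for j
  proof -
    have "1 \<le> K" "1 \<le> K * (c * p)"
      using \<open>c > 0\<close> \<open>p > 0\<close> by (auto simp: K_def max_def field_simps)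
    then have "real (j + 1) \<le> K * (1 + c * p * j)"
      using mult_right_mono[of 1 "K * (c * p)" "real j"] by (simp add: algebra_simps)
    also have "\<dots> \<le> K * exp (c * p * j)"
      using \<open>1 \<le> K\<close> by (intro mult_left_mono exp_ge_add_one_self) auto
    finally show ?thesis .
  qed
  have bound: "measure lebesgue (dyadic_cube (- int j) m) powr (r - 1 / p) *
      (\<Sum>k | dyadic_cube 0 k \<subseteq> dyadic_cube (- int j) m. cmod (indicator S k) powr p) powr (1 / p)
      \<le> K powr (1 / p)" for j and m :: "int ^ 'd"
  proof -
    have "(\<Sum>k | dyadic_cube 0 k \<subseteq> dyadic_cube (- int j) m. cmod (indicator S k) powr p) =
        (\<Sum>k | dyadic_cube 0 k \<subseteq> dyadic_cube (- int j) m. indicator S k)"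
      by (intro sum.cong) (auto simp: indicator_def)
    also have "\<dots> = real (card (S \<inter> {k. dyadic_cube 0 k \<subseteq> dyadic_cube (- int j) m}))"
      by (simp add: indicator_def sum.If_cases finite_dyadic_subcubes Int_commute)
    also have "\<dots> \<le> K * exp (c * p * j)"
      using card[of j m] growth[of j] by linarith
    finally have "(\<Sum>k | dyadic_cube 0 k \<subseteq> dyadic_cube (- int j) m. cmod (indicator S k) powr p) powr (1 / p)
        \<le> (K * exp (c * p * j)) powr (1 / p)"
      using \<open>p > 0\<close> by (intro powr_mono2) (auto intro: sum_nonneg)
    \<comment> \<open>The outer power \<open>1 / p\<close> turns the rate \<open>c * p\<close> into
      \<open>c\<close>, which the weight cancels.\<close>
    also have "\<dots> = K powr (1 / p) * exp (c * j)"
      using \<open>p > 0\<close> by (simp add: powr_mult K_def powr_def[of "exp _"])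
    finally have "measure lebesgue (dyadic_cube (- int j) m) powr (r - 1 / p) *
        (\<Sum>k | dyadic_cube 0 k \<subseteq> dyadic_cube (- int j) m. cmod (indicator S k) powr p) powr (1 / p)
        \<le> exp (- (c * j)) * (K powr (1 / p) * exp (c * j))"
      by (intro mult_mono)
         (auto simp: measure_dyadic_cube powr_def ln_realpow c_def algebra_simps)
    then show ?thesis
      by (simp add: exp_minus field_simps)
  qed
  have "m_norm u p (indicator S) \<le> ennreal (K powr (1 / p))"
    unfolding m_norm_def r_def[symmetric]
    by (intro SUP_least) (auto intro!: ennreal_leI bound)
  then show ?thesis
    unfolding m_space_def by (auto intro: order.strict_trans1)
qed

theorem proposition1p8:
  fixes p :: real and u :: ereal
  assumes "0 < p" and "ereal p < u"
  shows "\<not> separable_space (m_topology u p :: (int ^ 'd::finite \<Rightarrow> complex) topology)"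
proof
  assume sep: "separable_space (m_topology u p :: (int ^ 'd \<Rightarrow> complex) topology)"
  define ind :: "nat set \<Rightarrow> int ^ 'd \<Rightarrow> complex" where "ind A = indicator (diagonal_power ` A)" for A
  define U where "U A = {b \<in> m_space u p. \<exists>s<1/2. \<forall>k. cmod (b k - ind A k) \<le> s}" for A
  have "ind A \<in> m_space u p" for A
    unfolding ind_def
  proof (rule sparse_indicator_in_m_space[OF assms])
    fix j and m :: "int ^ 'd"
    show "card (diagonal_power ` A \<inter> {k. dyadic_cube 0 k \<subseteq> dyadic_cube (- int j) m}) \<le> j + 1"
      by (rule order_trans[OF card_mono card_diagonal_power_in_dyadic_cube])
         (auto intro: finite_subset[OF _ finite_dyadic_subcubes])
  qed
  then have "ind A \<in> U A" for A
    by (auto simp: U_def intro: exI[of _ 0])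
  moreover have "disjoint_family_on U UNIV"
  proof -
    \<comment> \<open>A common point \<open>b\<close> forces the two indicators to differ by less
      than 1/2 + 1/2 = 1 everywhere; their values are 0 or 1, so they agree.\<close>
    have "A = B" if b: "b \<in> U A" "b \<in> U B" for A B b
    proof -
      have "n \<in> A \<longleftrightarrow> n \<in> B" for n
      proof -
        let ?k = "diagonal_power n"
        have "cmod (b ?k - ind A ?k) < 1/2" "cmod (b ?k - ind B ?k) < 1/2"
          using b unfolding U_def by (blast intro: le_less_trans)+
        then have "cmod (ind A ?k - ind B ?k) < 1"
          using norm_triangle_ineq4[of "b ?k - ind B ?k" "b ?k - ind A ?k"] by simp
        then show ?thesis
          by (auto simp: ind_def indicator_def inj_image_mem_iff[OF inj_diagonal_power] of_bool_def split: if_splits)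
      qed
      then show ?thesis by blast
    qed
    then show ?thesis
      unfolding disjoint_family_on_def by blast
  qed
  ultimately have "countable (UNIV :: nat set set)"
    by (intro separable_space_imp_countable_disjoint_open[OF sep, of UNIV U])
       (use openin_m_topology_sup_ball[OF assms(1)] in \<open>unfold U_def, blast+\<close>)
  \<comment> \<open>An injection of the power set of the naturals into the naturals has an inverse
    that is onto, against Cantor's theorem.\<close>
  then obtain f :: "nat set \<Rightarrow> nat" where "inj f"
    by (auto simp: countable_def)
  then have "(\<lambda>A. inv f A) ` UNIV = (Pow UNIV :: nat set set)"
    by (auto simp: image_iff) (metis inv_f_f)
  then show False
    by (metis Cantors_theorem)
qed

end
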